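(* Let $F=z\,\hat U(x,f)$, $f=c^2\hat Z(x,t)$, be a ${\cal UZ}$-Finsler metric function, and let $h_{ij}=F\,\partial l_i/\partial y^j$ with $l_i=\partial F/\partial y^i$. Then the components of the tensor $h_{ij}$ are $$h_{33}={\cal U}_1f^2,\quad h_{31}=-{\cal U}_1 f f_1,\quad h_{32}=-{\cal U}_1 f f_2,$$ $$h_{11}={\cal U}_1f_1f_1+{\cal U}_2f_{11},\quad h_{12}={\cal U}_1f_1f_2+{\cal U}_2f_{12},\quad h_{22}={\cal U}_1f_2f_2+{\cal U}_2f_{22},$$ where ${\cal U}_1=U\,U_{ff}$, ${\cal U}_2=U\,U_f$, $U=\hat U(x,f)$, $U_f=\partial\hat U/\partial f$, $U_{ff}=\partial^2\hat U/\partial f^2$, and $f_a=\partial f/\partial c^a$, $f_{ab}=\partial^2 f/\partial c^a\partial c^b$ for $a,b\in\{1,2\}$.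
   Context: Setting. ${\cal M}$ is a three-dimensional differentiable manifold carrying three vector fields, given through one-forms, linearly independent at each point $x$. At a point $x$, a tangent vector $y$ is described by its components $y^1,y^2,y^3$ with respect to the corresponding basis, and all tensor components are taken with respect to $(y^1,y^2,y^3)$. Put $z=y^3$, $c^1=y^1/z$, $c^2=y^2/z$, $t=y^1/y^2=c^1/c^2$, on the region $z>0$, $y^2>0$. A ${\cal UZ}$-Finsler metric function is a Finsler metric function (sufficiently smooth, positively homogeneous of degree one in $y$) of the form $F=z\,\hat U(x,f)$, $f=c^2\,\hat Z(x,t)$. Via $t=c^1/c^2$, $f$ is regarded as a function of $(x,c^1,c^2)$. The metric tensor is $g_{ij}=\frac12\,\partial^2F^2/\partial y^i\partial y^j=l_il_j+h_{ij}$. *)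

theory Defs
  imports "HOL-Analysis.Analysis"
begin

text \<open>Maps of class \<open>C^k\<close> on an open set. In finite dimensions, continuity of every
  directional derivative \<open>p \<mapsto> Df(p) v\<close> is continuity of \<open>Df\<close>.\<close>

fun Ck_on :: "nat \<Rightarrow> ('a::euclidean_space \<Rightarrow> 'b::euclidean_space) \<Rightarrow> 'a set \<Rightarrow> bool" where
  "Ck_on 0 f S \<longleftrightarrow> continuous_on S f"
| "Ck_on (Suc k) f S \<longleftrightarrow>
     (\<forall>p\<in>S. f differentiable (at p)) \<and>
     (\<forall>v. Ck_on k (\<lambda>p. frechet_derivative f (at p) v) S)"

definition partial :: "'n::finite \<Rightarrow> (real^'n \<Rightarrow> real) \<Rightarrow> real^'n \<Rightarrow> real" where
  "partial i G y = deriv (\<lambda>s. G (y + s *\<^sub>R axis i 1)) 0"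


text \<open>A chart is a pair (domain, coordinate map).\<close>

type_synonym 'm chart = "'m set \<times> ('m \<Rightarrow> real^3)"

abbreviation chart_inv :: "'m chart \<Rightarrow> real^3 \<Rightarrow> 'm" where
  "chart_inv c \<equiv> inv_into (fst c) (snd c)"

definition transition :: "'m chart \<Rightarrow> 'm chart \<Rightarrow> real^3 \<Rightarrow> real^3" where
  "transition c d = snd d \<circ> chart_inv c"

definition manifold3 :: "nat \<Rightarrow> 'm topology \<Rightarrow> 'm chart set \<Rightarrow> bool" where
  "manifold3 k M A \<longleftrightarrow>
     Hausdorff_space M \<and> second_countable M \<and>
     (\<Union>c\<in>A. fst c) = topspace M \<and>
     (\<forall>c\<in>A. openin M (fst c) \<and> open (snd c ` fst c) \<and>
        homeomorphic_map (subtopology M (fst c)) (top_of_set (snd c ` fst c)) (snd c)) \<and>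
     (\<forall>c\<in>A. \<forall>d\<in>A. Ck_on k (transition c d) (snd c ` (fst c \<inter> fst d)))"

text \<open>A tangent vector at \<open>x\<close> is represented by the family of its coordinate vectors in all the
  charts around \<open>x\<close>, which transform into each other by the Jacobians of the transition maps;
  the value at any other argument is fixed to 0, so that the representation is unique.\<close>

type_synonym 'm tangent = "'m chart \<Rightarrow> real^3"

definition tangent_space :: "'m chart set \<Rightarrow> 'm \<Rightarrow> 'm tangent set" where
  "tangent_space A x =
     {v. (\<forall>c\<in>A. \<forall>d\<in>A. x \<in> fst c \<longrightarrow> x \<in> fst d \<longrightarrow>
            v d = frechet_derivative (transition c d) (at (snd c x)) (v c)) \<and>
         (\<forall>c. \<not> (c \<in> A \<and> x \<in> fst c) \<longrightarrow> v c = 0)}"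

text \<open>Joint regularity in \<open>(x, s)\<close>, read in the charts of the manifold, of a function on a
  subset \<open>W\<close> of the product of the manifold with a Euclidean space.\<close>

definition Ck_along ::
  "nat \<Rightarrow> 'm chart set \<Rightarrow> ('m \<Rightarrow> 'b::euclidean_space \<Rightarrow> 'c::euclidean_space) \<Rightarrow> ('m \<times> 'b) set \<Rightarrow> bool" where
  "Ck_along k A G W \<longleftrightarrow>
     (\<forall>c\<in>A. Ck_on k (\<lambda>(p, s). G (chart_inv c p) s)
              {(p, s). p \<in> snd c ` fst c \<and> (chart_inv c p, s) \<in> W})"

text \<open>The tangent vector at \<open>x\<close> with components \<open>y\<close> with respect to \<open>E 1 x, E 2 x, E 3 x\<close>.
  In the index type \<open>3\<close> the numeral \<open>3\<close> equals \<open>0\<close>; the indices \<open>1, 2, 3\<close> are distinct.\<close>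

definition frame_vec :: "(3 \<Rightarrow> 'm \<Rightarrow> 'm tangent) \<Rightarrow> 'm \<Rightarrow> real^3 \<Rightarrow> 'm tangent" where
  "frame_vec E x y = (\<lambda>c. \<Sum>i\<in>UNIV. (y $ i) *\<^sub>R E i x c)"

text \<open>Three linearly independent vector fields \<open>E\<close> of class \<open>C^k\<close> together with the dual
  one-forms \<open>\<theta>\<close>, so that \<open>\<theta> i x v\<close> is the component \<open>y^i\<close> of the tangent vector \<open>v\<close> at \<open>x\<close>.\<close>

definition framed ::
  "nat \<Rightarrow> 'm topology \<Rightarrow> 'm chart set \<Rightarrow> (3 \<Rightarrow> 'm \<Rightarrow> 'm tangent) \<Rightarrow> (3 \<Rightarrow> 'm \<Rightarrow> 'm tangent \<Rightarrow> real) \<Rightarrow> bool" where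
  "framed k M A E \<theta> \<longleftrightarrow>
     (\<forall>i. \<forall>x\<in>topspace M. E i x \<in> tangent_space A x) \<and>
     (\<forall>i. \<forall>c\<in>A. Ck_on k (\<lambda>p. E i (chart_inv c p) c) (snd c ` fst c)) \<and>
     (\<forall>x\<in>topspace M. \<forall>a. frame_vec E x a = (\<lambda>c. 0) \<longrightarrow> a = 0) \<and>
     (\<forall>i. \<forall>x\<in>topspace M. \<forall>v\<in>tangent_space A x. \<forall>w\<in>tangent_space A x. \<forall>a b.
        \<theta> i x (\<lambda>c. a *\<^sub>R v c + b *\<^sub>R w c) = a * \<theta> i x v + b * \<theta> i x w) \<and>
     (\<forall>i j. \<forall>x\<in>topspace M. \<theta> i x (E j x) = (if i = j then 1 else 0))"


text \<open>The part \<open>z > 0, y^2 > 0\<close> of the tangent space, intrinsically and in components.\<close>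

definition region :: "'m chart set \<Rightarrow> (3 \<Rightarrow> 'm \<Rightarrow> 'm tangent \<Rightarrow> real) \<Rightarrow> 'm \<Rightarrow> 'm tangent set" where
  "region A \<theta> x = {v \<in> tangent_space A x. \<theta> 3 x v > 0 \<and> \<theta> 2 x v > 0}"

definition comp_region :: "(real^3) set" where
  "comp_region = {y. y $ 3 > 0 \<and> y $ 2 > 0}"

definition in_comps :: "(3 \<Rightarrow> 'm \<Rightarrow> 'm tangent) \<Rightarrow> ('m \<Rightarrow> 'm tangent \<Rightarrow> real) \<Rightarrow> 'm \<Rightarrow> real^3 \<Rightarrow> real" where
  "in_comps E F x y = F x (frame_vec E x y)"

definition finsler ::
  "nat \<Rightarrow> 'm topology \<Rightarrow> 'm chart set \<Rightarrow> (3 \<Rightarrow> 'm \<Rightarrow> 'm tangent) \<Rightarrow> (3 \<Rightarrow> 'm \<Rightarrow> 'm tangent \<Rightarrow> real) \<Rightarrow>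
   ('m \<Rightarrow> 'm tangent \<Rightarrow> real) \<Rightarrow> bool" where
  "finsler k M A E \<theta> F \<longleftrightarrow>
     Ck_along k A (in_comps E F) (topspace M \<times> comp_region) \<and>
     (\<forall>x\<in>topspace M. \<forall>v\<in>region A \<theta> x. \<forall>r>0. F x (\<lambda>c. r *\<^sub>R v c) = r * F x v)"

text \<open>\<open>f = c^2 Z(x, c^1/c^2)\<close> as a function of \<open>x\<close> and \<open>c = (c^1, c^2)\<close>.\<close>

definition uz_f :: "('m \<Rightarrow> real \<Rightarrow> real) \<Rightarrow> 'm \<Rightarrow> real^2 \<Rightarrow> real" where
  "uz_f Z x c = c $ 2 * Z x (c $ 1 / c $ 2)"

text \<open>\<open>U(x, _)\<close> need only be defined near the values taken by \<open>f\<close>: its domain is an open set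
  \<open>W\<close> containing all pairs \<open>(x, f)\<close>.\<close>

definition uz_finsler ::
  "nat \<Rightarrow> 'm topology \<Rightarrow> 'm chart set \<Rightarrow> (3 \<Rightarrow> 'm \<Rightarrow> 'm tangent) \<Rightarrow> (3 \<Rightarrow> 'm \<Rightarrow> 'm tangent \<Rightarrow> real) \<Rightarrow>
   ('m \<Rightarrow> real \<Rightarrow> real) \<Rightarrow> ('m \<Rightarrow> real \<Rightarrow> real) \<Rightarrow> ('m \<Rightarrow> 'm tangent \<Rightarrow> real) \<Rightarrow> bool" where
  "uz_finsler k M A E \<theta> U Z F \<longleftrightarrow>
     finsler k M A E \<theta> F \<and>
     Ck_along k A Z (topspace M \<times> UNIV) \<and>
     (\<exists>W. openin (prod_topology M euclideanreal) W \<and>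
          (\<forall>x\<in>topspace M. \<forall>c. c $ 2 > 0 \<longrightarrow> (x, uz_f Z x c) \<in> W) \<and>
          Ck_along k A U W) \<and>
     (\<forall>x\<in>topspace M. \<forall>v\<in>region A \<theta> x.
        F x v = \<theta> 3 x v * U x (uz_f Z x (vector [\<theta> 1 x v / \<theta> 3 x v, \<theta> 2 x v / \<theta> 3 x v])))"

definition l_form :: "(3 \<Rightarrow> 'm \<Rightarrow> 'm tangent) \<Rightarrow> ('m \<Rightarrow> 'm tangent \<Rightarrow> real) \<Rightarrow> 'm \<Rightarrow> 3 \<Rightarrow> real^3 \<Rightarrow> real" where
  "l_form E F x i y = partial i (in_comps E F x) y"

definition h_tensor :: "(3 \<Rightarrow> 'm \<Rightarrow> 'm tangent) \<Rightarrow> ('m \<Rightarrow> 'm tangent \<Rightarrow> real) \<Rightarrow> 'm \<Rightarrow> real^3 \<Rightarrow> 3 \<Rightarrow> 3 \<Rightarrow> real" where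
  "h_tensor E F x y i j = in_comps E F x y * partial j (l_form E F x i) y"

end

theory Submission
  imports Defs
begin

text \<open>Fix \<open>x\<close>. Since \<open>c\<^sup>1/c\<^sup>2 = y\<^sup>1/y\<^sup>2\<close>, in components the metric function is the explicit
  one-variable expression
  \<open>F = y\<^sup>3 U(f)\<close> with \<open>f = (y\<^sup>2/y\<^sup>3) Z(y\<^sup>1/y\<^sup>2)\<close>, and the theorem is the chain rule applied twice:
  because \<open>y\<^sup>3 f\<close> does not depend on \<open>y\<^sup>3\<close>, one gets
  \<open>l\<^sub>1 = U' f\<^sub>1\<close>, \<open>l\<^sub>2 = U' f\<^sub>2\<close>, \<open>l\<^sub>3 = U - f U'\<close>, where \<open>f\<^sub>1 = Z'\<close> and \<open>f\<^sub>2 = Z - t Z'\<close> depend on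
  \<open>t = y\<^sup>1/y\<^sup>2\<close> only. In the derivative of \<open>l\<^sub>3\<close> the terms in \<open>U'\<close> cancel, which leaves only
  \<open>-f U'' df\<close>; hence the entries with an index 3 carry no \<open>U\<^sub>2\<close>. The factor \<open>y\<^sup>3\<close> of \<open>F\<close> absorbs the
  \<open>1/y\<^sup>3\<close> that comes from \<open>c\<^sup>a = y\<^sup>a/y\<^sup>3\<close>.

  Two preliminary points make this calculation applicable. The joint regularity of \<open>U\<close> and \<open>Z\<close> in a
  chart has to be restricted to a fibre over \<open>x\<close> (\<open>Ck_along_fibre_derivatives\<close>). And
  the linear combination of the frame with coefficients \<open>y\<close> has to be recognised as a tangent vector
  whose components, measured by the one-forms, are again \<open>y\<close>
  (\<open>frame_vec_tangent_and_components\<close>), so that the defining formula for \<open>F\<close> can be evaluated on it.\<close>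

section \<open>Derivatives along a fibre\<close>

lemma Ck_on_slice_derivative:
  fixes G :: "'a::euclidean_space \<times> real \<Rightarrow> real"
  assumes "Ck_on (Suc k) G S" and "(p, s) \<in> S"
  shows "((\<lambda>s. G (p, s)) has_real_derivative frechet_derivative G (at (p, s)) (0, 1)) (at s)"
proof -
  let ?D = "frechet_derivative G (at (p, s))"
  have D: "(G has_derivative ?D) (at (p, s))"
    using assms by (simp add: frechet_derivative_works)
  have "((\<lambda>s. (p, s)) has_derivative (\<lambda>h. (0, h))) (at s)"
    by (auto intro!: derivative_eq_intros)
  from diff_chain_at[OF this D]
  have "((\<lambda>s. G (p, s)) has_derivative (\<lambda>h. ?D (0, h))) (at s)"
    by (simp add: o_def)
  moreover have "(\<lambda>h. ?D (0, h)) = (*) (?D (0, 1))"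
  proof
    show "?D (0, h) = ?D (0, 1) * h" for h
      using linear_scale[OF has_derivative_linear[OF D], of h "(0, 1)"]
      by (simp add: mult.commute)
  qed
  ultimately show ?thesis
    by (simp add: has_field_derivative_def)
qed

lemma chart_around:
  assumes "manifold3 k M A" and "x \<in> topspace M"
  obtains c where "c \<in> A" and "x \<in> fst c" and "chart_inv c (snd c x) = x"
proof -
  have "(\<Union>c\<in>A. fst c) = topspace M"
    and chart: "\<forall>c\<in>A. openin M (fst c) \<and> open (snd c ` fst c) \<and>
      homeomorphic_map (subtopology M (fst c)) (top_of_set (snd c ` fst c)) (snd c)"
    using assms(1) unfolding manifold3_def by (iprover elim: conjE)+
  with assms(2) obtain c where c: "c \<in> A" "x \<in> fst c"
    by blast
  have "openin M (fst c)"
    and "homeomorphic_map (subtopology M (fst c)) (top_of_set (snd c ` fst c)) (snd c)"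
    using bspec[OF chart c(1)] by (iprover elim: conjE)+
  then have "inj_on (snd c) (fst c)"
    using homeomorphic_imp_injective_map openin_subset topspace_subtopology_subset by metis
  with c that show thesis by (simp add: inv_into_f_f)
qed

text \<open>The second derivative along the fibre is the slice derivative of a directional derivative of
  the chart expression in the fibre direction, which is itself of class \<open>C\<^sup>k\<^sup>+\<^sup>1\<close>.\<close>

lemma Ck_along_fibre_derivatives:
  fixes G :: "'m \<Rightarrow> real \<Rightarrow> real"
  assumes "manifold3 m M A" and "x \<in> topspace M" and "Ck_along (Suc (Suc k)) A G W"
  obtains G' G'' where
    "\<And>s. (x, s) \<in> W \<Longrightarrow> (G x has_real_derivative G' s) (at s)"
    "\<And>s. (x, s) \<in> W \<Longrightarrow> (G' has_real_derivative G'' s) (at s)"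
proof -
  obtain c where c: "c \<in> A" "x \<in> fst c" "chart_inv c (snd c x) = x"
    by (rule chart_around[OF assms(1,2)])
  define H where "H = (\<lambda>(p, s). G (chart_inv c p) s)"
  define S where "S = {(p, s). p \<in> snd c ` fst c \<and> (chart_inv c p, s) \<in> W}"
  define H' where "H' = (\<lambda>q. frechet_derivative H (at q) (0, 1))"
  have H: "Ck_on (Suc (Suc k)) H S"
    using assms(3) c(1) unfolding Ck_along_def H_def S_def by blast
  then have H': "Ck_on (Suc k) H' S"
    unfolding H'_def Ck_on.simps(2)[of "Suc k"] by blast
  have S: "(snd c x, s) \<in> S" if "(x, s) \<in> W" for s
    using that c(2) by (simp add: S_def c(3))
  have G: "G x = (\<lambda>s. H (snd c x, s))"
    using c by (simp add: H_def)
  show thesis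
  proof (rule that)
    show "(G x has_real_derivative H' (snd c x, s)) (at s)" if "(x, s) \<in> W" for s
      unfolding G H'_def by (rule Ck_on_slice_derivative[OF H S[OF that]])
    show "((\<lambda>s. H' (snd c x, s)) has_real_derivative
        frechet_derivative H' (at (snd c x, s)) (0, 1)) (at s)" if "(x, s) \<in> W" for s
      by (rule Ck_on_slice_derivative[OF H' S[OF that]])
  qed
qed

lemma open_fibre:
  assumes "openin (prod_topology M euclideanreal) W"
  shows "open {s. (x, s) \<in> W}"
proof (rule Topological_Spaces.openI)
  fix s assume "s \<in> {s. (x, s) \<in> W}"
  then have "\<exists>V T. openin M V \<and> openin euclideanreal T \<and> x \<in> V \<and> s \<in> T \<and> V \<times> T \<subseteq> W"
    using assms unfolding openin_prod_topology_alt by simp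
  then obtain V T where "openin euclideanreal T" "s \<in> T" "x \<in> V" "V \<times> T \<subseteq> W"
    by (elim exE conjE)
  then have "open T \<and> s \<in> T \<and> T \<subseteq> {s. (x, s) \<in> W}"
    by auto
  then show "\<exists>T. open T \<and> s \<in> T \<and> T \<subseteq> {s. (x, s) \<in> W}" ..
qed

section \<open>Components with respect to the frame\<close>

text \<open>The compatibility condition between charts is preserved because the transition maps are
  differentiable, so that their Jacobians are linear; at a point of non-differentiability
  \<open>frechet_derivative\<close> would be an unspecified function.\<close>

lemma tangent_space_combination:
  assumes M: "manifold3 (Suc k) M A"
    and v: "v \<in> tangent_space A x" and w: "w \<in> tangent_space A x"
  shows "(\<lambda>c. a *\<^sub>R v c + b *\<^sub>R w c) \<in> tangent_space A x"
proof -
  have J_linear: "linear (frechet_derivative (transition c d) (at (snd c x)))"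
    if "c \<in> A" "d \<in> A" "x \<in> fst c" "x \<in> fst d" for c d
  proof (rule linear_frechet_derivative)
    have "Ck_on (Suc k) (transition c d) (snd c ` (fst c \<inter> fst d))"
      using M that unfolding manifold3_def by blast
    then show "transition c d differentiable (at (snd c x))"
      using that by auto
  qed
  show ?thesis
    unfolding tangent_space_def
  proof (intro CollectI conjI ballI allI impI)
    fix c d assume cd: "c \<in> A" "d \<in> A" "x \<in> fst c" "x \<in> fst d"
    let ?J = "frechet_derivative (transition c d) (at (snd c x))"
    have "v d = ?J (v c)" "w d = ?J (w c)"
      using v w cd unfolding tangent_space_def by blast+
    then show "a *\<^sub>R v d + b *\<^sub>R w d = ?J (a *\<^sub>R v c + b *\<^sub>R w c)"
      by (simp only: linear_add[OF J_linear[OF cd]] linear_scale[OF J_linear[OF cd]])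
  next
    fix c assume "\<not> (c \<in> A \<and> x \<in> fst c)"
    then have "v c = 0" "w c = 0"
      using v w unfolding tangent_space_def by blast+
    then show "a *\<^sub>R v c + b *\<^sub>R w c = 0" by simp
  qed
qed

lemma frame_vec_tangent_and_components:
  assumes M: "manifold3 (Suc k) M A" and fr: "framed r M A E \<theta>" and x: "x \<in> topspace M"
  shows "frame_vec E x y \<in> tangent_space A x" and "\<theta> i x (frame_vec E x y) = y $ i"
proof -
  have E: "E j x \<in> tangent_space A x" for j
    using fr x by (auto simp: framed_def)
  have dual: "\<theta> i x (E j x) = (if i = j then 1 else 0)" for i j
    using fr x by (auto simp: framed_def)
  have lin: "\<theta> i x (\<lambda>c. a *\<^sub>R v c + b *\<^sub>R w c) = a * \<theta> i x v + b * \<theta> i x w"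
    if "v \<in> tangent_space A x" "w \<in> tangent_space A x" for i v w a b
    using fr x that unfolding framed_def by blast
  note comb = tangent_space_combination[OF M]
  let ?v = "\<lambda>c. (y $ 1) *\<^sub>R E 1 x c + (y $ 2) *\<^sub>R E 2 x c"
  \<comment> \<open>Linearity of the one-forms concerns two vectors at a time, hence the nesting.\<close>
  have eq: "frame_vec E x y = (\<lambda>c. 1 *\<^sub>R ?v c + (y $ 3) *\<^sub>R E 3 x c)"
    by (simp add: frame_vec_def sum_3)
  have v: "?v \<in> tangent_space A x"
    by (rule comb[OF E E])
  show "frame_vec E x y \<in> tangent_space A x"
    unfolding eq by (rule comb[OF v E])
  show "\<theta> i x (frame_vec E x y) = y $ i"
    unfolding eq lin[OF v E] lin[OF E E] dual
    using exhaust_3[of i] by auto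
qed

lemma uz_finsler_in_comps:
  assumes "manifold3 (Suc k) M A" and "framed r M A E \<theta>" and "uz_finsler r M A E \<theta> U Z F"
    and "x \<in> topspace M" and "y \<in> comp_region"
  shows "in_comps E F x y = y $ 3 * U x (y $ 2 / y $ 3 * Z x (y $ 1 / y $ 2))"
proof -
  note fv = frame_vec_tangent_and_components[OF assms(1,2,4)]
  have "frame_vec E x y \<in> region A \<theta> x"
    using assms(5) fv by (simp add: region_def comp_region_def)
  then have "F x (frame_vec E x y) =
      y $ 3 * U x (uz_f Z x (vector [y $ 1 / y $ 3, y $ 2 / y $ 3]))"
    using assms(3,4) fv(2) by (simp add: uz_finsler_def)
  then show ?thesis
    using assms(5) by (simp add: in_comps_def uz_f_def comp_region_def vector_2)
qed

section \<open>The chain rule\<close>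

text \<open>Partial derivatives are local. The closed forms of the function and of its first partial
  derivatives hold on an open region only, and this is what allows them to be differentiated again.\<close>

lemma partial_eqI:
  fixes G H :: "real^'n::finite \<Rightarrow> real"
  assumes "open S" and "y \<in> S" and "\<And>v. v \<in> S \<Longrightarrow> G v = H v"
    and "((\<lambda>s. H (y + s *\<^sub>R axis i 1)) has_real_derivative D) (at 0)"
  shows "partial i G y = D"
proof -
  have "continuous_on UNIV (\<lambda>s. y + s *\<^sub>R axis i (1::real))"
    by (intro continuous_intros)
  then have "open ((\<lambda>s. y + s *\<^sub>R axis i (1::real)) -` S)"
    using assms(1) by (simp add: open_vimage continuous_on_eq_continuous_at)
  then have "eventually (\<lambda>s. s \<in> (\<lambda>s. y + s *\<^sub>R axis i (1::real)) -` S) (nhds 0)"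
    using assms(2) by (intro eventually_nhds_in_open) auto
  then have "eventually (\<lambda>s. G (y + s *\<^sub>R axis i 1) = H (y + s *\<^sub>R axis i 1)) (nhds 0)"
    by eventually_elim (simp add: assms(3))
  then have "((\<lambda>s. G (y + s *\<^sub>R axis i 1)) has_real_derivative D) (at 0)"
    using assms(4) by (simp add: DERIV_cong_ev)
  then show ?thesis
    by (simp add: partial_def DERIV_imp_deriv)
qed

lemma open_positive_components:
  "open {c :: real^2. c $ 2 > 0}" "open comp_region"
  unfolding comp_region_def
  by (intro open_Collect_conj open_Collect_less continuous_intros)+

lemma component_along_axis:
  "((\<lambda>s. (v + s *\<^sub>R axis i (1::real)) $ j) has_real_derivative (if i = j then 1 else 0)) (at 0)"
proof (cases "i = j")
  case True
  have "((\<lambda>s. v $ j + s) has_real_derivative 1) (at 0)"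
    by (auto intro!: derivative_eq_intros)
  with True show ?thesis by (simp add: axis_def)
qed (simp add: axis_def)

lemma quotient_along_axis:
  assumes "v $ k \<noteq> 0"
  shows "((\<lambda>s. (v + s *\<^sub>R axis i (1::real)) $ j / (v + s *\<^sub>R axis i 1) $ k) has_real_derivative
    ((if i = j then 1 else 0) - v $ j / v $ k * (if i = k then 1 else 0)) / v $ k) (at 0)"
  by (rule DERIV_cong[OF DERIV_divide[OF component_along_axis component_along_axis]])
    (use assms in \<open>simp_all add: divide_simps\<close>)

text \<open>As \<open>f\<close> is homogeneous of degree one in \<open>c\<close>, its first partial derivatives are functions of
  \<open>t = c\<^sup>1/c\<^sup>2\<close> alone, and all second ones are multiples of \<open>Z''(t)\<close>.\<close>

lemma uz_f_partials:
  fixes Z :: "'m \<Rightarrow> real \<Rightarrow> real" and c :: "real^2"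
  assumes Z: "\<And>t. (Z x has_real_derivative Z' t) (at t)"
    and Z': "\<And>t. (Z' has_real_derivative Z'' t) (at t)"
    and c: "c $ 2 > 0"
  shows "partial 1 (uz_f Z x) c = Z' (c $ 1 / c $ 2)"
    and "partial 2 (uz_f Z x) c = Z x (c $ 1 / c $ 2) - c $ 1 / c $ 2 * Z' (c $ 1 / c $ 2)"
    and "partial 1 (partial 1 (uz_f Z x)) c = Z'' (c $ 1 / c $ 2) / c $ 2"
    and "partial 1 (partial 2 (uz_f Z x)) c = - (c $ 1 / (c $ 2)\<^sup>2) * Z'' (c $ 1 / c $ 2)"
    and "partial 2 (partial 2 (uz_f Z x)) c = (c $ 1)\<^sup>2 / (c $ 2) ^ 3 * Z'' (c $ 1 / c $ 2)"
proof -
  let ?S = "{c :: real^2. c $ 2 > 0}"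
  define t where "t = (\<lambda>v :: real^2. v $ 1 / v $ 2)"
  let ?L = "\<lambda>i v s. v + s *\<^sub>R axis i 1 :: real^2"
  have dt: "((\<lambda>s. t (?L i v s)) has_real_derivative
      ((if i = 1 then 1 else 0) - t v * (if i = 2 then 1 else 0)) / v $ 2) (at 0)"
    if "v \<in> ?S" for i v
    using quotient_along_axis[of v 2 i 1] that unfolding t_def by simp
  have dZ: "((\<lambda>s. Z x (t (?L i v s))) has_real_derivative Z' (t v) * D) (at 0)"
    and dZ': "((\<lambda>s. Z' (t (?L i v s))) has_real_derivative Z'' (t v) * D) (at 0)"
    if "((\<lambda>s. t (?L i v s)) has_real_derivative D) (at 0)" for i v D
    using DERIV_chain2[OF Z that] DERIV_chain2[OF Z' that] by simp_all
  note transfer = partial_eqI[OF open_positive_components(1)]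
  have f: "uz_f Z x v = v $ 2 * Z x (t v)" for v
    by (simp add: uz_f_def t_def)
  have p1: "partial 1 (uz_f Z x) v = Z' (t v)"
    and p2: "partial 2 (uz_f Z x) v = Z x (t v) - t v * Z' (t v)" if v: "v \<in> ?S" for v
    by (rule transfer[OF v f],
        rule DERIV_cong[OF DERIV_mult[OF component_along_axis dZ[OF dt[OF v]]]],
        use v in \<open>simp add: field_simps\<close>)+
  have S: "c \<in> ?S" using c by simp
  show "partial 1 (uz_f Z x) c = Z' (c $ 1 / c $ 2)"
    using p1[OF S] by (simp add: t_def)
  show "partial 2 (uz_f Z x) c = Z x (c $ 1 / c $ 2) - c $ 1 / c $ 2 * Z' (c $ 1 / c $ 2)"
    using p2[OF S] by (simp add: t_def)
  have p11: "partial 1 (partial 1 (uz_f Z x)) c = Z'' (t c) / c $ 2"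
    by (rule transfer[OF S p1], assumption, rule DERIV_cong[OF dZ'[OF dt[OF S]]]) simp
  have p_2: "partial i (partial 2 (uz_f Z x)) c =
      - t c * Z'' (t c) * (((if i = 1 then 1 else 0) - t c * (if i = 2 then 1 else 0)) / c $ 2)" for i
    by (rule transfer[OF S p2], assumption, rule DERIV_cong[OF DERIV_diff[OF
          dZ[OF dt[OF S]] DERIV_mult[OF dt[OF S] dZ'[OF dt[OF S]]]]])
      (simp add: algebra_simps)
  show "partial 1 (partial 1 (uz_f Z x)) c = Z'' (c $ 1 / c $ 2) / c $ 2"
    and "partial 1 (partial 2 (uz_f Z x)) c = - (c $ 1 / (c $ 2)\<^sup>2) * Z'' (c $ 1 / c $ 2)"
    and "partial 2 (partial 2 (uz_f Z x)) c = (c $ 1)\<^sup>2 / (c $ 2) ^ 3 * Z'' (c $ 1 / c $ 2)"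
    using p11 p_2[of 1] p_2[of 2]
    by (simp_all add: t_def power2_eq_square power3_eq_cube mult.commute)
qed

text \<open>These are the derivatives of the covector \<open>l\<close>, for the function of the components to which \<open>F\<close>
  reduces. In terms of \<open>t = y\<^sup>1/y\<^sup>2\<close>, the factors \<open>Z'(t)\<close> and \<open>Z(t) - t Z'(t)\<close>
  are \<open>f\<^sub>1\<close> and \<open>f\<^sub>2\<close>, and the last summands, with \<open>Z''(t)\<close>, are the terms in \<open>f\<^sub>a\<^sub>b\<close>.\<close>

lemma uz_component_partials:
  fixes G :: "real^3 \<Rightarrow> real" and U U' U'' Z Z' Z'' :: "real \<Rightarrow> real" and y :: "real^3"
  defines "\<phi> \<equiv> \<lambda>v :: real^3. v $ 2 / v $ 3 * Z (v $ 1 / v $ 2)"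
    and "t \<equiv> \<lambda>v :: real^3. v $ 1 / v $ 2"
  assumes G_eq: "\<forall>v\<in>comp_region. G v = v $ 3 * U (\<phi> v)"
    and Z: "\<And>t. (Z has_real_derivative Z' t) (at t)"
    and Z': "\<And>t. (Z' has_real_derivative Z'' t) (at t)"
    and DU: "\<forall>v\<in>comp_region. (U has_real_derivative U' (\<phi> v)) (at (\<phi> v))"
    and DU': "\<forall>v\<in>comp_region. (U' has_real_derivative U'' (\<phi> v)) (at (\<phi> v))"
    and y: "y \<in> comp_region"
  shows "partial 3 (partial 3 G) y = U'' (\<phi> y) * (\<phi> y)\<^sup>2 / y $ 3"
    and "partial 1 (partial 3 G) y = - \<phi> y * U'' (\<phi> y) * Z' (t y) / y $ 3"
    and "partial 2 (partial 3 G) y = - \<phi> y * U'' (\<phi> y) * (Z (t y) - t y * Z' (t y)) / y $ 3"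
    and "partial 1 (partial 1 G) y = U'' (\<phi> y) * (Z' (t y))\<^sup>2 / y $ 3 + U' (\<phi> y) * Z'' (t y) / y $ 2"
    and "partial 2 (partial 1 G) y =
      U'' (\<phi> y) * Z' (t y) * (Z (t y) - t y * Z' (t y)) / y $ 3 - U' (\<phi> y) * t y * Z'' (t y) / y $ 2"
    and "partial 2 (partial 2 G) y =
      U'' (\<phi> y) * (Z (t y) - t y * Z' (t y))\<^sup>2 / y $ 3 + U' (\<phi> y) * (t y)\<^sup>2 * Z'' (t y) / y $ 2"
proof -
  note G = bspec[OF G_eq] and U = bspec[OF DU] and U' = bspec[OF DU']
  let ?L = "\<lambda>i v s. v + s *\<^sub>R axis i 1 :: real^3"
  have pos: "v $ 2 > 0" "v $ 3 > 0" if "v \<in> comp_region" for v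
    using that by (auto simp: comp_region_def)
  have dt: "((\<lambda>s. t (?L i v s)) has_real_derivative
      ((if i = 1 then 1 else 0) - t v * (if i = 2 then 1 else 0)) / v $ 2) (at 0)"
    if "v \<in> comp_region" for i v
    using quotient_along_axis[of v 2 i 1] pos[OF that] unfolding t_def by simp
  have dZ: "((\<lambda>s. Z (t (?L i v s))) has_real_derivative Z' (t v) * D) (at 0)"
    and dZ': "((\<lambda>s. Z' (t (?L i v s))) has_real_derivative Z'' (t v) * D) (at 0)"
    if "((\<lambda>s. t (?L i v s)) has_real_derivative D) (at 0)" for i v D
    using DERIV_chain2[OF Z that] DERIV_chain2[OF Z' that] by simp_all
  have \<phi>_t: "\<phi> = (\<lambda>v. v $ 2 / v $ 3 * Z (t v))"
    by (simp add: \<phi>_def t_def)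
  have d\<phi>: "((\<lambda>s. \<phi> (?L i v s)) has_real_derivative
      (if i = 1 then Z' (t v) else if i = 2 then Z (t v) - t v * Z' (t v) else - \<phi> v) / v $ 3) (at 0)"
    if v: "v \<in> comp_region" for i v
    unfolding \<phi>_t
    by (rule DERIV_cong[OF DERIV_mult[OF quotient_along_axis dZ[OF dt[OF v]]]])
      (use pos[OF v] exhaust_3[of i] in \<open>auto simp: field_simps\<close>)
  have dU: "((\<lambda>s. U (\<phi> (?L i v s))) has_real_derivative U' (\<phi> v) * D) (at 0)"
    and dU': "((\<lambda>s. U' (\<phi> (?L i v s))) has_real_derivative U'' (\<phi> v) * D) (at 0)"
    if "v \<in> comp_region" "((\<lambda>s. \<phi> (?L i v s)) has_real_derivative D) (at 0)" for i v D
    using DERIV_chain2[OF _ that(2), of U] DERIV_chain2[OF _ that(2), of U'] U[OF that(1)] U'[OF that(1)]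
    by simp_all
  note transfer = partial_eqI[OF open_positive_components(2)]
  have l1: "partial 1 G v = U' (\<phi> v) * Z' (t v)"
    and l2: "partial 2 G v = U' (\<phi> v) * (Z (t v) - t v * Z' (t v))"
    and l3: "partial 3 G v = U (\<phi> v) - \<phi> v * U' (\<phi> v)"
    if v: "v \<in> comp_region" for v
    by (rule transfer[OF v G], assumption,
        rule DERIV_cong[OF DERIV_mult[OF component_along_axis dU[OF v d\<phi>[OF v]]]],
        use pos[OF v] in \<open>simp add: field_simps\<close>)+
  \<comment> \<open>The two contributions with the factor \<open>U'\<close>, from \<open>U\<close> and from the factor \<open>\<phi>\<close>, cancel.\<close>
  have l3': "partial i (partial 3 G) y = - \<phi> y * U'' (\<phi> y) * D"
    if "((\<lambda>s. \<phi> (?L i y s)) has_real_derivative D) (at 0)" for i D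
    by (rule transfer[OF y l3], assumption,
        rule DERIV_cong[OF DERIV_diff[OF dU[OF y that] DERIV_mult[OF that dU'[OF y that]]]])
      (simp add: algebra_simps)
  show "partial 3 (partial 3 G) y = U'' (\<phi> y) * (\<phi> y)\<^sup>2 / y $ 3"
    and "partial 1 (partial 3 G) y = - \<phi> y * U'' (\<phi> y) * Z' (t y) / y $ 3"
    and "partial 2 (partial 3 G) y = - \<phi> y * U'' (\<phi> y) * (Z (t y) - t y * Z' (t y)) / y $ 3"
    by (simp_all add: l3'[OF d\<phi>[OF y]] power2_eq_square)
  show "partial 1 (partial 1 G) y = U'' (\<phi> y) * (Z' (t y))\<^sup>2 / y $ 3 + U' (\<phi> y) * Z'' (t y) / y $ 2"
    by (rule transfer[OF y l1], assumption,
        rule DERIV_cong[OF DERIV_mult[OF dU'[OF y d\<phi>[OF y]] dZ'[OF dt[OF y]]]])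
      (use pos[OF y] in \<open>simp add: field_simps power2_eq_square\<close>)
  show "partial 2 (partial 1 G) y =
      U'' (\<phi> y) * Z' (t y) * (Z (t y) - t y * Z' (t y)) / y $ 3 - U' (\<phi> y) * t y * Z'' (t y) / y $ 2"
    by (rule transfer[OF y l1], assumption,
        rule DERIV_cong[OF DERIV_mult[OF dU'[OF y d\<phi>[OF y]] dZ'[OF dt[OF y]]]])
      (use pos[OF y] in \<open>simp add: field_simps power2_eq_square\<close>)
  show "partial 2 (partial 2 G) y =
      U'' (\<phi> y) * (Z (t y) - t y * Z' (t y))\<^sup>2 / y $ 3 + U' (\<phi> y) * (t y)\<^sup>2 * Z'' (t y) / y $ 2"
    by (rule transfer[OF y l2], assumption,
        rule DERIV_cong[OF DERIV_mult[OF dU'[OF y d\<phi>[OF y]]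
          DERIV_diff[OF dZ[OF dt[OF y]] DERIV_mult[OF dt[OF y] dZ'[OF dt[OF y]]]]]])
      (use pos[OF y] in \<open>simp add: field_simps power2_eq_square\<close>)
qed

section \<open>The components of the tensor\<close>

theorem proposition3p1:
  fixes r :: nat
    and M :: "'m topology" and A :: "'m chart set"
    and E :: "3 \<Rightarrow> 'm \<Rightarrow> 'm tangent" and \<theta> :: "3 \<Rightarrow> 'm \<Rightarrow> 'm tangent \<Rightarrow> real"
    and U Z :: "'m \<Rightarrow> real \<Rightarrow> real" and F :: "'m \<Rightarrow> 'm tangent \<Rightarrow> real"
    and x :: 'm and y :: "real^3"
  assumes "2 \<le> r"
    and "manifold3 (Suc r) M A"
    and "framed r M A E \<theta>"
    and "uz_finsler r M A E \<theta> U Z F"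
    and "x \<in> topspace M" and "y $ 3 > 0" and "y $ 2 > 0"
  shows "let c = vector [y $ 1 / y $ 3, y $ 2 / y $ 3] :: real^2;
             f = uz_f Z x c;
             f\<^sub>1 = partial 1 (uz_f Z x) c;
             f\<^sub>2 = partial 2 (uz_f Z x) c;
             f\<^sub>1\<^sub>1 = partial 1 (partial 1 (uz_f Z x)) c;
             f\<^sub>1\<^sub>2 = partial 1 (partial 2 (uz_f Z x)) c;
             f\<^sub>2\<^sub>2 = partial 2 (partial 2 (uz_f Z x)) c;
             U\<^sub>1 = U x f * deriv (deriv (U x)) f;
             U\<^sub>2 = U x f * deriv (U x) f;
             h = h_tensor E F x y
         in h 3 3 = U\<^sub>1 * f^2 \<and>
            h 3 1 = - U\<^sub>1 * f * f\<^sub>1 \<and>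
            h 3 2 = - U\<^sub>1 * f * f\<^sub>2 \<and>
            h 1 1 = U\<^sub>1 * f\<^sub>1 * f\<^sub>1 + U\<^sub>2 * f\<^sub>1\<^sub>1 \<and>
            h 1 2 = U\<^sub>1 * f\<^sub>1 * f\<^sub>2 + U\<^sub>2 * f\<^sub>1\<^sub>2 \<and>
            h 2 2 = U\<^sub>1 * f\<^sub>2 * f\<^sub>2 + U\<^sub>2 * f\<^sub>2\<^sub>2"
proof -
  define f where "f = (\<lambda>v :: real^3. v $ 2 / v $ 3 * Z x (v $ 1 / v $ 2))"
  have y: "y \<in> comp_region"
    using assms by (simp add: comp_region_def)
  obtain k where r: "r = Suc (Suc k)"
    using assms(1) by (metis Suc_le_D numeral_2_eq_2 Suc_le_mono)
  have "Ck_along (Suc (Suc k)) A Z (topspace M \<times> UNIV)"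
    using assms(4) by (simp add: uz_finsler_def r)
  from Ck_along_fibre_derivatives[OF assms(2,5) this] obtain Z' Z'' where
    Z: "\<And>t. (Z x has_real_derivative Z' t) (at t)"
    and Z': "\<And>t. (Z' has_real_derivative Z'' t) (at t)"
    using assms(5) by (metis SigmaI UNIV_I)
  obtain W where W: "openin (prod_topology M euclideanreal) W"
    and fW: "\<And>c. c $ 2 > 0 \<Longrightarrow> (x, uz_f Z x c) \<in> W"
    and UW: "Ck_along (Suc (Suc k)) A U W"
    using assms(4,5) unfolding uz_finsler_def r by blast
  obtain U' U'' where
    U: "\<And>s. (x, s) \<in> W \<Longrightarrow> (U x has_real_derivative U' s) (at s)"
    and U': "\<And>s. (x, s) \<in> W \<Longrightarrow> (U' has_real_derivative U'' s) (at s)"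
    by (rule Ck_along_fibre_derivatives[OF assms(2,5) UW]) blast
  have uz_f_eq: "uz_f Z x (vector [v $ 1 / v $ 3, v $ 2 / v $ 3]) = f v"
    if "v \<in> comp_region" for v
    using that by (simp add: uz_f_def f_def comp_region_def vector_2)
  have f_in_W: "(x, f v) \<in> W" if "v \<in> comp_region" for v
    using fW[of "vector [v $ 1 / v $ 3, v $ 2 / v $ 3]"] that uz_f_eq[OF that]
    by (simp add: comp_region_def vector_2)
  have dU: "deriv (U x) s = U' s" if "(x, s) \<in> W" for s
    using DERIV_imp_deriv[OF U[OF that]] .
  have ddU: "deriv (deriv (U x)) (f y) = U'' (f y)"
  proof (rule DERIV_imp_deriv)
    \<comment> \<open>\<open>U'\<close> is the derivative of \<open>U x\<close> on the whole open fibre of \<open>W\<close>, so it may be replaced by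
      \<open>deriv (U x)\<close> before differentiating again.\<close>
    have "eventually (\<lambda>s. s \<in> {s. (x, s) \<in> W}) (nhds (f y))"
      using open_fibre[OF W] f_in_W[OF y] by (intro eventually_nhds_in_open) auto
    then have "eventually (\<lambda>s. deriv (U x) s = U' s) (nhds (f y))"
      by eventually_elim (simp add: dU)
    then show "(deriv (U x) has_real_derivative U'' (f y)) (at (f y))"
      using U'[OF f_in_W[OF y]] by (simp add: DERIV_cong_ev)
  qed
  have F: "\<forall>v\<in>comp_region. in_comps E F x v = v $ 3 * U x (f v)"
    unfolding f_def by (intro ballI uz_finsler_in_comps[OF assms(2-5)])
  have U_f: "\<forall>v\<in>comp_region. (U x has_real_derivative U' (f v)) (at (f v))"
    and U'_f: "\<forall>v\<in>comp_region. (U' has_real_derivative U'' (f v)) (at (f v))"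
    using U U' f_in_W by blast+
  note partials_F = uz_component_partials[where G = "in_comps E F x" and U = "U x" and Z = "Z x",
    OF F[unfolded f_def] Z Z' U_f[unfolded f_def] U'_f[unfolded f_def] y,
    folded fun_cong[OF f_def]]
  define c :: "real^2" where "c = vector [y $ 1 / y $ 3, y $ 2 / y $ 3]"
  have c: "c $ 2 > 0" "c $ 1 / c $ 2 = y $ 1 / y $ 2" "c $ 1 = y $ 1 / y $ 3" "c $ 2 = y $ 2 / y $ 3"
    using assms(6,7) by (simp_all add: c_def vector_2)
  note partials_f = uz_f_partials[where Z = Z and x = x, OF Z Z' c(1), unfolded c(2)]
  have "l_form E F x i = partial i (in_comps E F x)" for i
    by (rule ext) (simp add: l_form_def)
  then have h: "h_tensor E F x y i j = y $ 3 * U x (f y) * partial j (partial i (in_comps E F x)) y"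
    for i j
    by (simp add: h_tensor_def bspec[OF F y])
  \<comment> \<open>\<open>h 1 2\<close> differentiates \<open>l\<^sub>1\<close> in direction 2, whereas \<open>f\<^sub>1\<^sub>2\<close> differentiates \<open>f\<^sub>2\<close> in
    direction 1; the agreement of the two orders is visible in the explicit formulas.\<close>
  show ?thesis
    unfolding Let_def c_def[symmetric] uz_f_eq[OF y, folded c_def] ddU dU[OF f_in_W[OF y]]
      h partials_F partials_f
    unfolding c(3,4)
    using assms(6,7) by (simp add: field_simps power2_eq_square power3_eq_cube)
qed

end
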